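(* Let $C_1,C_2\in\mathbb{C}^{N\times N}$ be indefinite Hermitian matrices, and for $i=1,2$ let $x_i$ be a unit eigenvector of $C_i$ corresponding to its minimum eigenvalue $\lambda_{\min}(C_i)$. Assume that $$x_1^{H}C_1x_1\le x_1^{H}C_2x_1\quad\text{and}\quad x_2^{H}C_2x_2\le x_2^{H}C_1x_2 .$$ Put $A_1=C_1$ and $A_2=C_1-C_2$. Then the optimization problem $$c^{\star}=\min_{u\in\mathbb{C}^N,\ u^{H}u=1}\ u^{H}A_1u\quad\text{subject to}\quad u^{H}A_2u=0$$ is equivalent to the max-min eigenvalue problem $$\max_{\lambda,t\in\mathbb{R}}\ \lambda\quad\text{subject to}\quad (A_1+tA_2)-\lambda I\succeq 0,$$ in the sense that the two problems have the same optimal value: $$c^{\star}=\max\{\lambda : \lambda,t\in\mathbb{R},\ (A_1+tA_2)-\lambda I\succeq 0\}.$$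
   Context: $u^{H}$ denotes conjugate transpose, $I$ the $N\times N$ identity matrix, and $A\succeq 0$ means that the Hermitian matrix $A$ is positive semidefinite. *)

theory Defs
  imports "HOL-Analysis.Analysis"
begin

definition conj_transpose :: "complex ^ 'n ^ 'm \<Rightarrow> complex ^ 'm ^ 'n" where
  "conj_transpose A = (\<chi> i j. cnj (A $ j $ i))"

definition hermitian :: "complex ^ 'n ^ 'n \<Rightarrow> bool" where
  "hermitian A \<longleftrightarrow> conj_transpose A = A"

text \<open>\<open>hdot u v\<close> is $u^H v$, conjugate-linear in the first argument. The library's
  \<open>u \<bullet> v\<close> on \<open>complex ^ 'n\<close> is only its real part.\<close>

definition hdot :: "complex ^ 'n \<Rightarrow> complex ^ 'n \<Rightarrow> complex" where
  "hdot u v = (\<Sum>i\<in>UNIV. cnj (u $ i) * v $ i)"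

text \<open>$u^H A u$. It is complex-valued by type, but real whenever \<open>A\<close> is Hermitian, so taking
  \<open>Re\<close> of it when comparing values loses nothing.\<close>

definition qform :: "complex ^ 'n ^ 'n \<Rightarrow> complex ^ 'n \<Rightarrow> complex" where
  "qform A u = hdot u (A *v u)"

definition pos_semidef :: "complex ^ 'n ^ 'n \<Rightarrow> bool" where
  "pos_semidef A \<longleftrightarrow> hermitian A \<and> (\<forall>u. 0 \<le> Re (qform A u))"

definition indefinite_hermitian :: "complex ^ 'n ^ 'n \<Rightarrow> bool" where
  "indefinite_hermitian A \<longleftrightarrow> hermitian A \<and> \<not> pos_semidef A \<and> \<not> pos_semidef (- A)"

definition eigenvector :: "complex ^ 'n ^ 'n \<Rightarrow> complex ^ 'n \<Rightarrow> complex \<Rightarrow> bool" where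
  "eigenvector A x \<mu> \<longleftrightarrow> x \<noteq> 0 \<and> A *v x = \<mu> *s x"

definition eigenvalue :: "complex ^ 'n ^ 'n \<Rightarrow> complex \<Rightarrow> bool" where
  "eigenvalue A \<mu> \<longleftrightarrow> (\<exists>x. eigenvector A x \<mu>)"

text \<open>Only meaningful for Hermitian \<open>A\<close>: then all eigenvalues are real, and the set below is
  finite and nonempty.\<close>

definition lambda_min :: "complex ^ 'n ^ 'n \<Rightarrow> real" where
  "lambda_min A = Min {l. eigenvalue A (complex_of_real l)}"

definition is_minimum :: "real set \<Rightarrow> real \<Rightarrow> bool" where
  "is_minimum S c \<longleftrightarrow> c \<in> S \<and> (\<forall>s\<in>S. c \<le> s)"

definition is_maximum :: "real set \<Rightarrow> real \<Rightarrow> bool" where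
  "is_maximum S c \<longleftrightarrow> c \<in> S \<and> (\<forall>s\<in>S. s \<le> c)"

end

theory Submission
  imports Defs
begin

text \<open>
  Write $p(u) = u^H A_1 u$ and $q(u) = u^H A_2 u$. Weak duality is immediate: on the set $q = 0$
  the form $p + tq$ agrees with $p$, so a $\lambda$ that is feasible for some $t$ bounds $p$ from
  below there. It remains to find a saddle point: a number $t$ and a unit vector $v$ with
  $q(v) = 0$ that minimises $p + tq$ over the whole unit sphere. Both optimal values then
  equal $p(v)$.

  The hypotheses confine the search to $t \in [-1, 0]$. At $t = 0$ the form $p + tq$ belongs to
  $C_1$, is minimised by $x_1$, and $q(x_1) \le 0$; at $t = -1$ it belongs to $C_2$, is minimised
  by $x_2$, and $q(x_2) \ge 0$. The parameters $t$ that have a minimiser with $q \le 0$ and those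
  that have one with $q \ge 0$ form two closed sets (by compactness of the sphere,
  \<open>closed_minimiser_parameters\<close>). They cover $[-1, 0]$ and contain $0$ and $-1$, respectively, so by
  connectedness they share some $t$ (\<open>quadratic_saddle_point\<close>). The minimisers
  for this $t$ thus include one with $q \<le> 0$ and one with $q \<ge> 0$, and the intermediate
  value theorem along the segment between them yields the required $v$ (\<open>sphere_minimiser_with_zero_form\<close>).

  That $x_i$ minimises the form of $C_i$ is the Rayleigh principle: a minimiser on the sphere
  is an eigenvector, so the least eigenvalue cannot exceed the minimum
  (\<open>Min_eigenvalues_le_quadratic\<close>).

  Only the real parts of the Hermitian products enter, and \<open>\<bullet>\<close> on complex vectors is exactly
  that real part. Hence the argument is carried out for linear operators on a real Euclidean
  space and then specialised to matrices.
\<close>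

section \<open>Real eigenvalues of a self-adjoint operator\<close>

text \<open>Eigenvectors for different eigenvalues are orthogonal, hence independent. Finiteness is
  what gives \<open>Min\<close> of this set its meaning.\<close>

lemma finite_real_eigenvalues:
  fixes T :: "'a::euclidean_space \<Rightarrow> 'a"
  assumes sa: "\<And>u v. u \<bullet> T v = T u \<bullet> v"
  shows "finite {l::real. \<exists>x. x \<noteq> 0 \<and> T x = l *\<^sub>R x}" (is "finite ?E")
proof -
  obtain f where f: "\<And>l. l \<in> ?E \<Longrightarrow> f l \<noteq> 0 \<and> T (f l) = l *\<^sub>R f l"
    using bchoice[of ?E "\<lambda>l x. x \<noteq> 0 \<and> T x = l *\<^sub>R x"] by auto
  have orth: "f k \<bullet> f l = 0" if "k \<in> ?E" "l \<in> ?E" "k \<noteq> l" for k l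
  proof -
    have "l * (f k \<bullet> f l) = k * (f k \<bullet> f l)"
      using sa[of "f k" "f l"] f[OF that(1)] f[OF that(2)] by simp
    with that(3) show ?thesis by simp
  qed
  have inj: "inj_on f ?E"
  proof (rule inj_onI, rule ccontr)
    fix k l assume "k \<in> ?E" "l \<in> ?E" "f k = f l" "k \<noteq> l"
    with orth[of k l] f[of l] show False by simp
  qed
  have "independent (f ` ?E)"
  proof (rule pairwise_orthogonal_independent)
    show "pairwise orthogonal (f ` ?E)"
      unfolding pairwise_def orthogonal_def using orth by fastforce
    show "0 \<notin> f ` ?E" using f by (metis (no_types, lifting) imageE)
  qed
  then have "finite (f ` ?E)" by (rule independent_imp_finite)
  with inj show ?thesis by (rule finite_imageD[rotated])
qed

lemma continuous_on_quadratic: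
  fixes T :: "'a::euclidean_space \<Rightarrow> 'a"
  assumes "linear T"
  shows "continuous_on S (\<lambda>u. u \<bullet> T u)"
  by (intro continuous_intros linear_continuous_on assms[THEN linear_conv_bounded_linear[THEN iffD1]])

lemma quadratic_scaleR:
  assumes "linear T"
  shows "(c *\<^sub>R u) \<bullet> T (c *\<^sub>R u) = c\<^sup>2 * (u \<bullet> T u)"
  by (simp add: linear_cmul[OF assms] power2_eq_square)

lemma quadratic_parallelogram:
  assumes "linear T"
  shows "(u + v) \<bullet> T (u + v) + (u - v) \<bullet> T (u - v) = 2 * (u \<bullet> T u) + 2 * (v \<bullet> T v)"
  by (simp add: linear_add[OF assms] linear_diff[OF assms] inner_simps)

lemma quadratic_attains_min:
  fixes T :: "'a::euclidean_space \<Rightarrow> 'a"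
  assumes "linear T"
  obtains v where "norm v = 1" "\<And>u. norm u = 1 \<Longrightarrow> v \<bullet> T v \<le> u \<bullet> T u"
proof -
  have "sphere (0::'a) 1 \<noteq> {}" by simp
  from continuous_attains_inf[OF compact_sphere this continuous_on_quadratic[OF assms]]
  show thesis using that by (auto simp: dist_norm)
qed

lemma quadratic_bound_from_sphere:
  fixes T :: "'a::euclidean_space \<Rightarrow> 'a"
  assumes lin: "linear T" and m: "\<And>u. norm u = 1 \<Longrightarrow> m \<le> u \<bullet> T u"
  shows "m * (u \<bullet> u) \<le> u \<bullet> T u"
proof (cases "u = 0")
  case True
  then show ?thesis by simp
next
  case False
  define w where "w = u /\<^sub>R norm u"
  have "u = norm u *\<^sub>R w" "norm w = 1" using False by (auto simp: w_def)
  then have "u \<bullet> T u = (norm u)\<^sup>2 * (w \<bullet> T w)"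
    using quadratic_scaleR[OF lin] by metis
  moreover have "(norm u)\<^sup>2 * m \<le> (norm u)\<^sup>2 * (w \<bullet> T w)"
    using m[OF \<open>norm w = 1\<close>] by (intro mult_left_mono) auto
  ultimately show ?thesis by (simp add: dot_square_norm mult.commute)
qed

text \<open>The residual \<open>w = T v - m v\<close> is the direction of the gradient of the nonnegative form
  $u \cdot T u - m \|u\|^2$ at its zero \<open>v\<close>. If it were nonzero, a small step against it
  would make that form negative.\<close>

lemma sphere_minimiser_is_eigenvector:
  fixes T :: "'a::euclidean_space \<Rightarrow> 'a"
  assumes lin: "linear T" and sa: "\<And>u v. u \<bullet> T v = T u \<bullet> v"
    and v: "norm v = 1" and min: "\<And>u. norm u = 1 \<Longrightarrow> v \<bullet> T v \<le> u \<bullet> T u"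
  shows "T v = (v \<bullet> T v) *\<^sub>R v"
proof -
  define m where "m = v \<bullet> T v"
  define w where "w = T v - m *\<^sub>R v"
  define e where "e = w \<bullet> T w - m * (w \<bullet> w)"
  have vv: "v \<bullet> v = 1" using v by (simp add: dot_square_norm)
  have bound: "m * (u \<bullet> u) \<le> u \<bullet> T u" for u
    by (rule quadratic_bound_from_sphere[OF lin]) (use min in \<open>simp add: m_def\<close>)
  have e: "0 \<le> e" using bound[of w] by (simp add: e_def)
  have Tv: "T v = w + m *\<^sub>R v" by (simp add: w_def)
  have pos: "0 \<le> 2 * s * (w \<bullet> w) + s\<^sup>2 * e" for s
  proof -
    have sw: "v \<bullet> T w = w \<bullet> w + m * (v \<bullet> w)"
      using sa[of v w] by (simp add: Tv inner_simps)
    have vw: "v \<bullet> w = 0" using Tv vv m_def by (simp add: w_def inner_simps)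
    have "(v + s *\<^sub>R w) \<bullet> T (v + s *\<^sub>R w) - m * ((v + s *\<^sub>R w) \<bullet> (v + s *\<^sub>R w))
        = 2 * s * (w \<bullet> w) + s\<^sup>2 * e"
      using vv vw sw
      by (simp add: linear_add[OF lin] linear_cmul[OF lin] Tv inner_simps e_def
          power2_eq_square algebra_simps inner_commute[of w v])
    with bound[of "v + s *\<^sub>R w"] show ?thesis by simp
  qed
  have "w \<bullet> w = 0"
  proof (rule ccontr)
    assume "w \<bullet> w \<noteq> 0"
    then have d: "0 < w \<bullet> w" by simp
    \<comment> \<open>The minimiser of the quadratic in \<open>s\<close>, with \<open>e\<close> raised to \<open>e + 1\<close> to avoid dividing by zero.\<close>
    define s where "s = - (w \<bullet> w) / (e + 1)"
    have s: "s * (e + 1) = - (w \<bullet> w)" using e by (simp add: s_def)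
    have "2 * s * (w \<bullet> w) + s\<^sup>2 * e \<le> 2 * s * (w \<bullet> w) + s * (s * (e + 1))"
      by (simp add: power2_eq_square algebra_simps)
    also have "\<dots> = s * (w \<bullet> w)" unfolding s by (simp add: algebra_simps)
    also have "\<dots> < 0" using d e by (simp add: s_def mult_neg_pos)
    finally show False using pos[of s] by simp
  qed
  then show ?thesis by (simp add: w_def m_def)
qed

lemma Min_eigenvalues_le_quadratic:
  fixes T :: "'a::euclidean_space \<Rightarrow> 'a"
  assumes lin: "linear T" and sa: "\<And>u v. u \<bullet> T v = T u \<bullet> v" and u: "norm u = 1"
  shows "Min {l. \<exists>x. x \<noteq> 0 \<and> T x = l *\<^sub>R x} \<le> u \<bullet> T u"
proof -
  obtain v where v: "norm v = 1" "\<And>u. norm u = 1 \<Longrightarrow> v \<bullet> T v \<le> u \<bullet> T u"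
    using quadratic_attains_min[OF lin] by blast
  have "v \<noteq> 0" using v(1) by auto
  then have "Min {l. \<exists>x. x \<noteq> 0 \<and> T x = l *\<^sub>R x} \<le> v \<bullet> T v"
    using sphere_minimiser_is_eigenvector[OF lin sa v]
    by (intro Min_le finite_real_eigenvalues sa) auto
  also have "\<dots> \<le> u \<bullet> T u" using v(2) u .
  finally show ?thesis .
qed

section \<open>A saddle point for a pair of quadratic forms\<close>

text \<open>The segment from \<open>a\<close> to \<open>b\<close> consists of zeros of the nonnegative form
  $R(u) = u \cdot P u - m \|u\|^2$, because by the parallelogram law two nonnegative values of $R$
  sum to zero. So a zero of the second form on the segment, once normalised, is a
  minimiser. Normalising fails only if the segment passes through the origin; then \<open>a\<close> and \<open>b\<close>
  are antipodal and the form vanishes at both.\<close>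

lemma sphere_minimiser_with_zero_form:
  fixes T P :: "'a::euclidean_space \<Rightarrow> 'a"
  assumes T: "linear T" and P: "linear P"
    and bound: "\<And>w. norm w = 1 \<Longrightarrow> m \<le> w \<bullet> P w"
    and a: "norm a = 1" "a \<bullet> P a = m" "a \<bullet> T a \<le> 0"
    and b: "norm b = 1" "b \<bullet> P b = m" "0 \<le> b \<bullet> T b"
  obtains v where "norm v = 1" "v \<bullet> P v = m" "v \<bullet> T v = 0"
proof -
  define z where "z s = (1 - s) *\<^sub>R a + s *\<^sub>R b" for s :: real
  define R where "R u = P u - m *\<^sub>R u" for u
  have R: "linear R"
    unfolding R_def[abs_def] by (intro linear_compose_sub P linear_scale_self)
  have R_eq: "u \<bullet> R u = u \<bullet> P u - m * (u \<bullet> u)" for u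
    by (simp add: R_def inner_simps)
  have nonneg: "0 \<le> u \<bullet> R u" for u
    using quadratic_bound_from_sphere[OF P bound, of u] by (simp add: R_eq)
  have unit: "a \<bullet> a = 1" "b \<bullet> b = 1" using a b by (auto simp: dot_square_norm)
  have zR: "z s \<bullet> R (z s) = 0" for s
  proof -
    have "z s \<bullet> R (z s) + ((1 - s) *\<^sub>R a - s *\<^sub>R b) \<bullet> R ((1 - s) *\<^sub>R a - s *\<^sub>R b) = 0"
      unfolding z_def quadratic_parallelogram[OF R] quadratic_scaleR[OF R]
      using a b unit by (simp add: R_eq)
    with nonneg[of "z s"] nonneg[of "(1 - s) *\<^sub>R a - s *\<^sub>R b"] show ?thesis by linarith
  qed
  have "continuous_on {0..1} (\<lambda>s. z s \<bullet> T (z s))"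
    by (rule continuous_on_compose2[OF continuous_on_quadratic[OF T, of UNIV]])
      (auto simp: z_def intro!: continuous_intros)
  then obtain s where s: "0 \<le> s" "s \<le> 1" "z s \<bullet> T (z s) = 0"
    using IVT'[of "\<lambda>s. z s \<bullet> T (z s)" 0 0 1] a b by (auto simp: z_def)
  show thesis
  proof (cases "z s = 0")
    case True
    then have eq: "(1 - s) *\<^sub>R a = (- s) *\<^sub>R b"
      by (simp add: z_def eq_neg_iff_add_eq_0)
    then have "norm ((1 - s) *\<^sub>R a) = norm ((- s) *\<^sub>R b)" by (rule arg_cong)
    then have half: "s = 1 / 2" using a b s by simp
    with eq have "a = - b" by (simp add: scaleR_right.minus[symmetric] del: scaleR_right.minus)
    then have "a \<bullet> T a = b \<bullet> T b" by (simp add: linear_neg[OF T])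
    with a b have "a \<bullet> T a = 0" by simp
    with a that show ?thesis by blast
  next
    case False
    define v where "v = z s /\<^sub>R norm (z s)"
    have v: "norm v = 1" using False by (simp add: v_def)
    have "v \<bullet> R v = 0" "v \<bullet> T v = 0"
      unfolding v_def by (simp_all only: quadratic_scaleR[OF R] quadratic_scaleR[OF T] zR s)
    with v that show ?thesis by (simp add: R_eq dot_square_norm)
  qed
qed

text \<open>The set is a projection of a compact set of pairs \<open>(t, u)\<close>. The factor \<open>c\<close> is there to be
  taken as \<open>1\<close> and \<open>- 1\<close>, which covers both signs of the form of \<open>T\<close>.\<close>

lemma closed_minimiser_parameters:
  fixes S T :: "'a::euclidean_space \<Rightarrow> 'a"
  assumes S: "linear S" and T: "linear T"
  shows "closed {t. a \<le> t \<and> t \<le> b \<and> (\<exists>u. norm u = 1 \<and> c * (u \<bullet> T u) \<le> 0 \<and>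
    (\<forall>w. norm w = 1 \<longrightarrow> u \<bullet> S u + t * (u \<bullet> T u) \<le> w \<bullet> S w + t * (w \<bullet> T w)))}" (is "closed ?X")
proof -
  define N where "N = {(t, u). c * (u \<bullet> T u) \<le> 0} \<inter> (\<Inter>w\<in>sphere 0 1.
    {(t, u). u \<bullet> S u + t * (u \<bullet> T u) \<le> w \<bullet> S w + t * (w \<bullet> T w)})"
  have cont: "continuous_on UNIV (\<lambda>p::real \<times> 'a. snd p \<bullet> S (snd p))"
    "continuous_on UNIV (\<lambda>p::real \<times> 'a. snd p \<bullet> T (snd p))"
    using continuous_on_compose2[OF continuous_on_quadratic[OF S, of UNIV]
        continuous_on_snd[OF continuous_on_id]]
      continuous_on_compose2[OF continuous_on_quadratic[OF T, of UNIV]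
        continuous_on_snd[OF continuous_on_id]] by auto
  have "closed {p::real \<times> 'a. c * (snd p \<bullet> T (snd p)) \<le> 0}"
    by (rule closed_Collect_le) (rule continuous_intros cont)+
  moreover have "closed {p::real \<times> 'a. snd p \<bullet> S (snd p) + fst p * (snd p \<bullet> T (snd p))
      \<le> w \<bullet> S w + fst p * (w \<bullet> T w)}" for w
    by (rule closed_Collect_le) (rule cont continuous_on_add continuous_on_mult
        continuous_on_fst continuous_on_id continuous_on_const)+
  ultimately have "closed N"
    unfolding N_def case_prod_unfold by (intro closed_Int closed_INT ballI)
  then have "compact (({a..b} \<times> sphere 0 1) \<inter> N)"
    by (intro compact_Int_closed compact_Times) auto
  then have "compact (fst ` (({a..b} \<times> sphere 0 1) \<inter> N))"
    by (intro compact_continuous_image continuous_intros)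
  moreover have "fst ` (({a..b} \<times> sphere 0 1) \<inter> N) = ?X"
  proof (rule set_eqI)
    fix t
    have "t \<in> fst ` K \<longleftrightarrow> (\<exists>u. (t, u) \<in> K)" for K :: "(real \<times> 'a) set"
      by force
    then show "t \<in> fst ` (({a..b} \<times> sphere 0 1) \<inter> N) \<longleftrightarrow> t \<in> ?X"
      by (simp add: N_def conj_ac Ball_def[of "sphere 0 1"])
  qed
  ultimately show ?thesis using compact_imp_closed by metis
qed

text \<open>In terms of the concave function $g(t) = \min_{\|u\|=1} (p(u) + t\,q(u))$, the value \<open>q u\<close> at a
  minimiser \<open>u\<close> is a supergradient of $g$ at $t$. The sign conditions at \<open>a\<close> and \<open>b\<close> thus place a maximiser
  of $g$ in between, and there \<open>v\<close> realises the supergradient $0$.\<close>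

lemma quadratic_saddle_point:
  fixes S T :: "'a::euclidean_space \<Rightarrow> 'a"
  assumes S: "linear S" and T: "linear T" and ab: "a \<le> b"
    and x: "norm x = 1" "x \<bullet> T x \<le> 0"
      "\<And>w. norm w = 1 \<Longrightarrow> x \<bullet> S x + b * (x \<bullet> T x) \<le> w \<bullet> S w + b * (w \<bullet> T w)"
    and y: "norm y = 1" "0 \<le> y \<bullet> T y"
      "\<And>w. norm w = 1 \<Longrightarrow> y \<bullet> S y + a * (y \<bullet> T y) \<le> w \<bullet> S w + a * (w \<bullet> T w)"
  obtains v t where "norm v = 1" "v \<bullet> T v = 0"
    "\<And>w. norm w = 1 \<Longrightarrow> v \<bullet> S v \<le> w \<bullet> S w + t * (w \<bullet> T w)"
proof -
  define P where "P t u = S u + t *\<^sub>R T u" for t u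
  have P: "linear (P t)" for t
    unfolding P_def[abs_def] by (intro linear_compose_add S linear_compose_scale_right T)
  have P_eq: "u \<bullet> P t u = u \<bullet> S u + t * (u \<bullet> T u)" for u t
    by (simp add: P_def inner_simps)
  define X where "X c = {t. a \<le> t \<and> t \<le> b \<and> (\<exists>u. norm u = 1 \<and> c * (u \<bullet> T u) \<le> 0 \<and>
    (\<forall>w. norm w = 1 \<longrightarrow> u \<bullet> S u + t * (u \<bullet> T u) \<le> w \<bullet> S w + t * (w \<bullet> T w)))}" for c :: real
  have closed: "closed (X c)" for c
    unfolding X_def by (rule closed_minimiser_parameters[OF S T])
  have cover: "{a..b} \<subseteq> X 1 \<union> X (- 1)"
  proof
    fix t assume t: "t \<in> {a..b}"
    obtain u where "norm u = 1" "\<And>w. norm w = 1 \<Longrightarrow> u \<bullet> P t u \<le> w \<bullet> P t w"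
      using quadratic_attains_min[OF P] by blast
    then show "t \<in> X 1 \<union> X (- 1)"
      using t linear[of "u \<bullet> T u" 0] unfolding X_def P_eq by auto
  qed
  have "b \<in> X 1" "a \<in> X (- 1)" using x y ab by (auto simp: X_def)
  then have "X 1 \<inter> X (- 1) \<inter> {a..b} \<noteq> {}"
    using connected_closedD[OF connected_Icc _ cover closed closed] ab by fastforce
  then obtain t where t: "t \<in> X 1" "t \<in> X (- 1)" by blast
  obtain u where u: "norm u = 1" "u \<bullet> T u \<le> 0" "\<And>w. norm w = 1 \<Longrightarrow> u \<bullet> P t u \<le> w \<bullet> P t w"
    using t(1) unfolding X_def P_eq by auto
  obtain u' where u': "norm u' = 1" "0 \<le> u' \<bullet> T u'"
      "\<And>w. norm w = 1 \<Longrightarrow> u' \<bullet> P t u' \<le> w \<bullet> P t w"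
    using t(2) unfolding X_def P_eq by auto
  have "u' \<bullet> P t u' = u \<bullet> P t u" using u u' by (meson antisym)
  with sphere_minimiser_with_zero_form[OF T P u(3) u(1) refl u(2) u'(1) _ u'(2)]
  obtain v where v: "norm v = 1" "v \<bullet> P t v = u \<bullet> P t u" "v \<bullet> T v = 0" by metis
  show thesis
  proof (rule that[OF v(1,3)])
    fix w :: 'a assume "norm w = 1"
    from u(3)[OF this] v show "v \<bullet> S v \<le> w \<bullet> S w + t * (w \<bullet> T w)" by (simp add: P_eq)
  qed
qed

section \<open>Hermitian matrices as real self-adjoint operators\<close>

lemma inner_eq_Re_hdot: "u \<bullet> v = Re (hdot u v)" for u v :: "complex ^ 'n"
  by (simp add: hdot_def inner_vec_def inner_complex_def)

lemma hdot_commute: "hdot v u = cnj (hdot u v)"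
  by (simp add: hdot_def mult.commute)

lemma hdot_self: "hdot u u = complex_of_real ((norm u)\<^sup>2)"
proof (rule complex_eqI)
  show "Re (hdot u u) = Re (complex_of_real ((norm u)\<^sup>2))"
    by (simp add: inner_eq_Re_hdot[symmetric] dot_square_norm)
  show "Im (hdot u u) = Im (complex_of_real ((norm u)\<^sup>2))"
    using arg_cong[OF hdot_commute[of u u], of Im] by simp
qed

lemma hdot_self_eq_1_iff: "hdot u u = 1 \<longleftrightarrow> norm u = 1"
proof -
  have "hdot u u = 1 \<longleftrightarrow> (norm u)\<^sup>2 = 1"
    unfolding hdot_self using of_real_eq_iff[of "(norm u)\<^sup>2" 1, where 'a = complex] by simp
  then show ?thesis using abs_square_eq_1[of "norm u"] by simp
qed

lemma hdot_matrix_hermitian: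
  assumes "hermitian A"
  shows "hdot u (A *v v) = hdot (A *v u) v"
proof -
  have A: "cnj (A $ i $ j) = A $ j $ i" for i j
    using assms unfolding hermitian_def conj_transpose_def vec_eq_iff by simp
  have "hdot u (A *v v) = (\<Sum>i\<in>UNIV. \<Sum>j\<in>UNIV. cnj (u $ i) * (A $ i $ j * v $ j))"
    by (simp add: hdot_def matrix_vector_mult_def sum_distrib_left)
  also have "\<dots> = (\<Sum>j\<in>UNIV. \<Sum>i\<in>UNIV. cnj (u $ i) * (A $ i $ j * v $ j))"
    by (rule sum.swap)
  also have "\<dots> = hdot (A *v u) v"
    by (simp add: hdot_def matrix_vector_mult_def sum_distrib_left sum_distrib_right A mult_ac)
  finally show ?thesis .
qed

lemma qform_Im_zero:
  assumes "hermitian A"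
  shows "Im (qform A u) = 0"
proof -
  have "qform A u = cnj (qform A u)"
    unfolding qform_def using hdot_matrix_hermitian[OF assms, of u u] hdot_commute by metis
  from arg_cong[OF this, of Im] show ?thesis by simp
qed

lemma Re_qform: "Re (qform A u) = u \<bullet> (A *v u)"
  by (simp add: qform_def inner_eq_Re_hdot)

lemma qform_eq_0_iff:
  assumes "hermitian A"
  shows "qform A u = 0 \<longleftrightarrow> u \<bullet> (A *v u) = 0"
  using qform_Im_zero[OF assms, of u] by (simp add: complex_eq_iff Re_qform)

lemma linear_matrix_complex: "linear ((*v) A)" for A :: "complex ^ 'n ^ 'm"
  by (rule linearI)
    (simp_all add: matrix_vector_right_distrib, simp add: matrix_vector_mult_def vec_eq_iff scaleR_right.sum)

lemma scaleR_matrix_complex: "(t *\<^sub>R A) *v u = t *\<^sub>R (A *v u)" for A :: "complex ^ 'n ^ 'm"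
  by (simp add: matrix_vector_mult_def vec_eq_iff scaleR_right.sum)

lemma hermitian_pencil:
  assumes "hermitian A" "hermitian B"
  shows "hermitian (A + t *\<^sub>R B - l *\<^sub>R mat 1)"
  using assms unfolding hermitian_def conj_transpose_def vec_eq_iff
  by (auto simp: mat_def)

lemma pos_semidef_pencil_iff:
  assumes "hermitian A" "hermitian B"
  shows "pos_semidef (A + t *\<^sub>R B - l *\<^sub>R mat 1) \<longleftrightarrow>
    (\<forall>u. norm u = 1 \<longrightarrow> l \<le> u \<bullet> (A *v u) + t * (u \<bullet> (B *v u)))"
proof -
  have eq: "Re (qform (A + t *\<^sub>R B - l *\<^sub>R mat 1) u)
      = u \<bullet> ((A + t *\<^sub>R B) *v u) - l * (u \<bullet> u)"
    and eq2: "u \<bullet> ((A + t *\<^sub>R B) *v u) = u \<bullet> (A *v u) + t * (u \<bullet> (B *v u))" for u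
    by (simp_all add: Re_qform matrix_vector_mult_add_rdistrib
        matrix_vector_mult_diff_rdistrib scaleR_matrix_complex inner_simps)
  show ?thesis
  proof
    assume psd: "pos_semidef (A + t *\<^sub>R B - l *\<^sub>R mat 1)"
    show "\<forall>u. norm u = 1 \<longrightarrow> l \<le> u \<bullet> (A *v u) + t * (u \<bullet> (B *v u))"
    proof (intro allI impI)
      fix u :: "complex ^ 'a" assume "norm u = 1"
      moreover have "0 \<le> u \<bullet> ((A + t *\<^sub>R B) *v u) - l * (u \<bullet> u)"
        using psd unfolding pos_semidef_def eq by blast
      ultimately show "l \<le> u \<bullet> (A *v u) + t * (u \<bullet> (B *v u))"
        by (simp add: eq2 dot_square_norm)
    qed
  next
    assume "\<forall>u. norm u = 1 \<longrightarrow> l \<le> u \<bullet> (A *v u) + t * (u \<bullet> (B *v u))"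
    then have "l * (u \<bullet> u) \<le> u \<bullet> ((A + t *\<^sub>R B) *v u)" for u
      by (intro quadratic_bound_from_sphere linear_matrix_complex) (simp add: eq2)
    then show "pos_semidef (A + t *\<^sub>R B - l *\<^sub>R mat 1)"
      unfolding pos_semidef_def eq using hermitian_pencil[OF assms] by simp
  qed
qed

lemma of_real_vector_scale: "complex_of_real l *s x = l *\<^sub>R x"
  by (simp add: vec_eq_iff) (simp add: scaleR_conv_of_real)

lemma lambda_min_le_quadratic:
  assumes "hermitian A" and "norm u = 1"
  shows "lambda_min A \<le> u \<bullet> (A *v u)"
proof -
  have "Min {l. \<exists>x. x \<noteq> 0 \<and> A *v x = l *\<^sub>R x} \<le> u \<bullet> (A *v u)"
    by (rule Min_eigenvalues_le_quadratic[OF linear_matrix_complex _ assms(2)])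
      (simp add: inner_eq_Re_hdot hdot_matrix_hermitian[OF assms(1)])
  then show ?thesis by (simp add: lambda_min_def eigenvalue_def eigenvector_def of_real_vector_scale)
qed

lemma eigenvector_lambda_min_minimises:
  assumes A: "hermitian A" and x: "norm x = 1"
    and ev: "eigenvector A x (complex_of_real (lambda_min A))"
    and w: "norm w = 1"
  shows "x \<bullet> (A *v x) \<le> w \<bullet> (A *v w)"
proof -
  have "A *v x = lambda_min A *\<^sub>R x"
    using ev by (simp add: eigenvector_def of_real_vector_scale)
  then have "x \<bullet> (A *v x) = lambda_min A" using x by (simp add: dot_square_norm)
  then show ?thesis using lambda_min_le_quadratic[OF A w] by simp
qed

section \<open>Equality of the optimal values\<close>

theorem mainTheorem2:
  fixes C1 C2 A1 A2 :: "complex ^ 'n ^ 'n" and x1 x2 :: "complex ^ 'n"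
  assumes "indefinite_hermitian C1" and "indefinite_hermitian C2"
    and "hdot x1 x1 = 1" and "eigenvector C1 x1 (complex_of_real (lambda_min C1))"
    and "hdot x2 x2 = 1" and "eigenvector C2 x2 (complex_of_real (lambda_min C2))"
    and "Re (qform C1 x1) \<le> Re (qform C2 x1)"
    and "Re (qform C2 x2) \<le> Re (qform C1 x2)"
    and "A1 = C1" and "A2 = C1 - C2"
  shows "\<exists>cstar::real.
      is_minimum {Re (qform A1 u) | u. hdot u u = 1 \<and> qform A2 u = 0} cstar \<and>
      is_maximum {l | (l::real) (t::real).
        pos_semidef ((A1 + t *\<^sub>R A2) - l *\<^sub>R mat 1)} cstar"
proof -
  have C1: "hermitian C1" and C2: "hermitian C2"
    using assms(1,2) by (auto simp: indefinite_hermitian_def)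
  have A1: "hermitian A1" using C1 assms(9) by simp
  have A2: "hermitian A2"
    using C1 C2 unfolding assms(10) hermitian_def conj_transpose_def vec_eq_iff by simp
  have x1: "norm x1 = 1" and x2: "norm x2 = 1"
    using assms(3,5) by (simp_all add: hdot_self_eq_1_iff)
  have A2_eq: "u \<bullet> (A2 *v u) = u \<bullet> (C1 *v u) - u \<bullet> (C2 *v u)" for u
    by (simp add: assms(10) matrix_vector_mult_diff_rdistrib inner_simps)
  \<comment> \<open>The pencil \<open>A1 + t A2\<close> is \<open>C2\<close> at \<open>t = - 1\<close> and \<open>C1\<close> at \<open>t = 0\<close>.\<close>
  obtain v t where v: "norm v = 1" "v \<bullet> (A2 *v v) = 0"
    and saddle: "\<And>w. norm w = 1 \<Longrightarrow> v \<bullet> (A1 *v v) \<le> w \<bullet> (A1 *v w) + t * (w \<bullet> (A2 *v w))"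
  proof (rule quadratic_saddle_point[OF linear_matrix_complex[of A1]
        linear_matrix_complex[of A2], where a = "- 1" and b = 0 and x = x1 and y = x2])
    show "x1 \<bullet> (A2 *v x1) \<le> 0" "0 \<le> x2 \<bullet> (A2 *v x2)"
      using assms(7,8) by (simp_all add: A2_eq Re_qform)
  next
    fix w :: "complex ^ 'n" assume w: "norm w = 1"
    show "x1 \<bullet> (A1 *v x1) + 0 * (x1 \<bullet> (A2 *v x1)) \<le> w \<bullet> (A1 *v w) + 0 * (w \<bullet> (A2 *v w))"
      using eigenvector_lambda_min_minimises[OF C1 x1 assms(4) w] by (simp add: assms(9))
    show "x2 \<bullet> (A1 *v x2) + - 1 * (x2 \<bullet> (A2 *v x2)) \<le> w \<bullet> (A1 *v w) + - 1 * (w \<bullet> (A2 *v w))"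
      using eigenvector_lambda_min_minimises[OF C2 x2 assms(6) w] by (simp add: assms(9) A2_eq)
  qed (use x1 x2 that in auto)
  define c where "c = v \<bullet> (A1 *v v)"
  have "is_minimum {Re (qform A1 u) | u. hdot u u = 1 \<and> qform A2 u = 0} c"
    unfolding is_minimum_def Re_qform hdot_self_eq_1_iff qform_eq_0_iff[OF A2]
  proof (intro conjI ballI)
    show "c \<in> {u \<bullet> (A1 *v u) | u. norm u = 1 \<and> u \<bullet> (A2 *v u) = 0}"
      using v c_def by blast
  next
    fix s assume "s \<in> {u \<bullet> (A1 *v u) | u. norm u = 1 \<and> u \<bullet> (A2 *v u) = 0}"
    then obtain u where "norm u = 1" "u \<bullet> (A2 *v u) = 0" "s = u \<bullet> (A1 *v u)" by blast
    with saddle[of u] show "c \<le> s" by (simp add: c_def)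
  qed
  moreover have "is_maximum {l | (l::real) (t::real).
      pos_semidef ((A1 + t *\<^sub>R A2) - l *\<^sub>R mat 1)} c"
    unfolding is_maximum_def pos_semidef_pencil_iff[OF A1 A2]
  proof (intro conjI ballI)
    show "c \<in> {l | l t. \<forall>u. norm u = 1 \<longrightarrow> l \<le> u \<bullet> (A1 *v u) + t * (u \<bullet> (A2 *v u))}"
      using saddle unfolding c_def by blast
  next
    fix s assume "s \<in> {l | l t. \<forall>u. norm u = 1 \<longrightarrow> l \<le> u \<bullet> (A1 *v u) + t * (u \<bullet> (A2 *v u))}"
    then obtain r where "\<forall>u. norm u = 1 \<longrightarrow> s \<le> u \<bullet> (A1 *v u) + r * (u \<bullet> (A2 *v u))" by blast
    with v have "s \<le> v \<bullet> (A1 *v v) + r * (v \<bullet> (A2 *v v))" by blast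
    with v show "s \<le> c" by (simp add: c_def)
  qed
  ultimately show ?thesis by blast
qed

end
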